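(* Let $p\ge1$ and $d\ge1$ be integers. A $p$-design in the projective space $\mathcal{P}(\mathbb{C}^d)$ is a tight $p$-fusion frame in $\mathbb{R}^{2d}$ with subspaces of equal dimension $2$. A $p$-design in the projective space $\mathcal{P}(\mathbb{H}^d)$ is a tight $p$-fusion frame in $\mathbb{R}^{4d}$ with subspaces of equal dimension $4$. (All weights are equal to $1$.)
   Context: Let $K=\mathbb{C}$ or $K=\mathbb{H}$ (the quaternions), and let $\mathcal{P}(K^d)$ be the projective space of lines $Kx$, $0\ne x\in K^d$. Let $h(x,y)=\sum_{i=1}^dx_i\overline{y_i}$ be the standard hermitian form on $K^d$. For $P_1,P_2\in\mathcal{P}(K^d)$, $t(P_1,P_2)$ is the common value of $|h(x_1,x_2)|^2$ for any $x_i\in P_i$ with $h(x_i,x_i)=1$. Let $\mathrm{Pol}_{\le p}(\mathcal{P}(K^d))$ be the span of the functions $P\mapsto t(P,Q)^p$, $Q\in\mathcal{P}(K^d)$, and let $\sigma$ be the normalized (probability, invariant under the isometry group of $h$) Lebesgue measure on $\mathcal{P}(K^d)$. A finite subset $\{P_j\}_{j=1}^n\subset\mathcal{P}(K^d)$ is a $p$-design if $$\int_{\mathcal{P}(K^d)}f\,d\sigma=\frac1n\sum_{j=1}^nf(P_j)\quad\text{for all }f\in\mathrm{Pol}_{\le p}(\mathcal{P}(K^d)).$$ $\mathbb{C}^d$ is identified with $\mathbb{R}^{2d}$ and $\mathbb{H}^d$ with $\mathbb{R}^{4d}$ in the usual way, so that $h(x,x)=\|x\|^2$; each element of $\mathcal{P}(K^d)$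 is then viewed as a real linear subspace of dimension $2$ (if $K=\mathbb{C}$) or $4$ (if $K=\mathbb{H}$). A finite collection $\{V_j\}_{j=1}^n$ of linear subspaces of $\mathbb{R}^D$ is a tight $p$-fusion frame (with weights equal to $1$) if there is a constant $A>0$ such that $\sum_{j=1}^n\|P_{V_j}(x)\|^{2p}=A\|x\|^{2p}$ for all $x\in\mathbb{R}^D$, where $P_V$ is the orthogonal projection onto $V$. *)

theory Defs
  imports "HOL-Analysis.Analysis"
begin

section \<open>Quaternions\<close>

codatatype quat = Quat (qRe: real) (qI: real) (qJ: real) (qK: real)

lemma quat_eqI: "\<lbrakk>qRe x = qRe y; qI x = qI y; qJ x = qJ y; qK x = qK y\<rbrakk> \<Longrightarrow> x = y"
  by (rule quat.expand) simp

lemma quat_eq_iff: "x = y \<longleftrightarrow> qRe x = qRe y \<and> qI x = qI y \<and> qJ x = qJ y \<and> qK x = qK y"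
  by (auto intro: quat_eqI)

instantiation quat :: ab_group_add
begin

primcorec zero_quat where
  "qRe 0 = 0" | "qI 0 = 0" | "qJ 0 = 0" | "qK 0 = 0"

primcorec plus_quat where
  "qRe (x + y) = qRe x + qRe y"
| "qI (x + y) = qI x + qI y"
| "qJ (x + y) = qJ x + qJ y"
| "qK (x + y) = qK x + qK y"

primcorec uminus_quat where
  "qRe (- x) = - qRe x" | "qI (- x) = - qI x" | "qJ (- x) = - qJ x" | "qK (- x) = - qK x"

primcorec minus_quat where
  "qRe (x - y) = qRe x - qRe y"
| "qI (x - y) = qI x - qI y"
| "qJ (x - y) = qJ x - qJ y"
| "qK (x - y) = qK x - qK y"

instance
  by standard (simp_all add: quat_eq_iff)

end

definition quat_cnj :: "quat \<Rightarrow> quat"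
  where "quat_cnj x = Quat (qRe x) (- qI x) (- qJ x) (- qK x)"

instantiation quat :: real_div_algebra
begin

primcorec one_quat where
  "qRe 1 = 1" | "qI 1 = 0" | "qJ 1 = 0" | "qK 1 = 0"

primcorec times_quat where
  "qRe (x * y) = qRe x * qRe y - qI x * qI y - qJ x * qJ y - qK x * qK y"
| "qI (x * y) = qRe x * qI y + qI x * qRe y + qJ x * qK y - qK x * qJ y"
| "qJ (x * y) = qRe x * qJ y - qI x * qK y + qJ x * qRe y + qK x * qI y"
| "qK (x * y) = qRe x * qK y + qI x * qJ y - qJ x * qI y + qK x * qRe y"

primcorec scaleR_quat where
  "qRe (scaleR r x) = r * qRe x"
| "qI (scaleR r x) = r * qI x"
| "qJ (scaleR r x) = r * qJ x"
| "qK (scaleR r x) = r * qK x"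

definition inverse_quat :: "quat \<Rightarrow> quat" where
  "inverse_quat x =
    scaleR (inverse ((qRe x)\<^sup>2 + (qI x)\<^sup>2 + (qJ x)\<^sup>2 + (qK x)\<^sup>2)) (quat_cnj x)"

definition divide_quat :: "quat \<Rightarrow> quat \<Rightarrow> quat"
  where "divide_quat x y = x * inverse y"

instance
proof
  fix x y z :: quat and a b :: real
  show "a *\<^sub>R (x + y) = a *\<^sub>R x + a *\<^sub>R y" by (simp add: quat_eq_iff algebra_simps)
  show "(a + b) *\<^sub>R x = a *\<^sub>R x + b *\<^sub>R x" by (simp add: quat_eq_iff algebra_simps)
  show "a *\<^sub>R b *\<^sub>R x = (a * b) *\<^sub>R x" by (simp add: quat_eq_iff)
  show "1 *\<^sub>R x = x" by (simp add: quat_eq_iff)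
  show "x * y * z = x * (y * z)" by (simp add: quat_eq_iff algebra_simps)
  show "1 * x = x" by (simp add: quat_eq_iff)
  show "x * 1 = x" by (simp add: quat_eq_iff)
  show "(x + y) * z = x * z + y * z" by (simp add: quat_eq_iff algebra_simps)
  show "x * (y + z) = x * y + x * z" by (simp add: quat_eq_iff algebra_simps)
  show "(0 :: quat) \<noteq> 1" by (simp add: quat_eq_iff)
  show "a *\<^sub>R x * y = a *\<^sub>R (x * y)" by (simp add: quat_eq_iff algebra_simps)
  show "x * a *\<^sub>R y = a *\<^sub>R (x * y)" by (simp add: quat_eq_iff algebra_simps)
  let ?n = "(qRe x)\<^sup>2 + (qI x)\<^sup>2 + (qJ x)\<^sup>2 + (qK x)\<^sup>2"
  have cnj: "quat_cnj x * x = scaleR ?n 1" "x * quat_cnj x = scaleR ?n 1"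
    by (simp_all add: quat_eq_iff quat_cnj_def power2_eq_square algebra_simps)
  have sc: "a *\<^sub>R u * v = a *\<^sub>R (u * v)" "u * a *\<^sub>R v = a *\<^sub>R (u * v)" for a and u v :: quat
    by (simp_all add: quat_eq_iff algebra_simps)
  have one: "inverse ?n *\<^sub>R ?n *\<^sub>R (1::quat) = 1" if "x \<noteq> 0"
  proof -
    have "?n \<noteq> 0"
      using that by (auto simp: quat_eq_iff add_nonneg_eq_0_iff)
    then show ?thesis by (simp add: quat_eq_iff)
  qed
  show "x \<noteq> 0 \<Longrightarrow> inverse x * x = 1"
    unfolding inverse_quat_def sc cnj by (rule one)
  show "x \<noteq> 0 \<Longrightarrow> x * inverse x = 1"
    unfolding inverse_quat_def sc cnj by (rule one)
  show "x div y = x * inverse y" by (rule divide_quat_def)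
  show "inverse (0::quat) = 0" by (simp add: inverse_quat_def quat_eq_iff quat_cnj_def)
qed

end

instantiation quat :: real_normed_div_algebra
begin

definition norm_quat :: "quat \<Rightarrow> real"
  where "norm_quat x = sqrt ((qRe x)\<^sup>2 + (qI x)\<^sup>2 + (qJ x)\<^sup>2 + (qK x)\<^sup>2)"

definition sgn_quat :: "quat \<Rightarrow> quat"
  where "sgn_quat x = x /\<^sub>R norm x"

definition dist_quat :: "quat \<Rightarrow> quat \<Rightarrow> real"
  where "dist_quat x y = norm (x - y)"

definition uniformity_quat :: "(quat \<times> quat) filter"
  where [code del]: "uniformity_quat = (INF e\<in>{0 <..}. principal {(x, y). dist x y < e})"

definition open_quat :: "quat set \<Rightarrow> bool"
  where [code del]: "open_quat U \<longleftrightarrow> (\<forall>x\<in>U. eventually (\<lambda>(x', y). x' = x \<longrightarrow> y \<in> U) uniformity)"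

instance
proof
  have norm_prod: "norm x = norm (qRe x, qI x, qJ x, qK x)" for x :: quat
    by (simp add: norm_quat_def norm_Pair add.assoc)
  have norm_sq: "(norm x)\<^sup>2 = (qRe x)\<^sup>2 + (qI x)\<^sup>2 + (qJ x)\<^sup>2 + (qK x)\<^sup>2" for x :: quat
    by (simp add: norm_quat_def)
  fix x y :: quat and a :: real
  show "sgn x = x /\<^sub>R norm x" by (rule sgn_quat_def)
  show "dist x y = norm (x - y)" by (rule dist_quat_def)
  show "uniformity = (INF e\<in>{0 <..}. principal {(x::quat, y). dist x y < e})"
    by (rule uniformity_quat_def)
  show "open U \<longleftrightarrow> (\<forall>x\<in>U. eventually (\<lambda>(x', y). x' = x \<longrightarrow> y \<in> U) uniformity)" for U :: "quat set"
    by (rule open_quat_def)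
  show "norm x = 0 \<longleftrightarrow> x = 0"
    by (simp add: norm_prod quat_eq_iff zero_prod_def)
  show "norm (x + y) \<le> norm x + norm y"
    using norm_triangle_ineq[of "(qRe x, qI x, qJ x, qK x)" "(qRe y, qI y, qJ y, qK y)"]
    by (simp add: norm_prod)
  have "(norm (a *\<^sub>R x))\<^sup>2 = (\<bar>a\<bar> * norm x)\<^sup>2"
    by (simp add: norm_sq power_mult_distrib algebra_simps)
  then show "norm (a *\<^sub>R x) = \<bar>a\<bar> * norm x"
    by (rule power2_eq_imp_eq) (simp_all add: norm_prod)
  have "(norm (x * y))\<^sup>2 = (norm x * norm y)\<^sup>2"
    by (simp add: norm_sq power_mult_distrib) (simp add: power2_eq_square algebra_simps)
  then show "norm (x * y) = norm x * norm y"
    by (rule power2_eq_imp_eq) (simp_all add: norm_prod)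
qed

end

lemma norm_quat_square: "(norm x)\<^sup>2 = (qRe x)\<^sup>2 + (qI x)\<^sup>2 + (qJ x)\<^sup>2 + (qK x)\<^sup>2"
  by (simp add: norm_quat_def)

section \<open>Scalars with a conjugation\<close>

text \<open>
  The two instances used are \<open>\<complex>\<close> and \<open>\<H>\<close>, which allows \<open>K\<^sup>d\<close> to be
  treated uniformly as \<open>'k ^ 'd\<close>.
\<close>

class real_conj_div_algebra = real_normed_div_algebra +
  fixes conj :: "'a \<Rightarrow> 'a"
  assumes conj_add: "conj (x + y) = conj x + conj y"
    and conj_mult: "conj (x * y) = conj y * conj x"
    and conj_conj: "conj (conj x) = x"
    and mult_conj: "x * conj x = ((norm x)\<^sup>2) *\<^sub>R 1"

instantiation complex :: real_conj_div_algebra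
begin
definition conj_complex :: "complex \<Rightarrow> complex" where "conj_complex = cnj"
instance
  by standard (unfold cmod_power2, simp_all add: conj_complex_def complex_eq_iff power2_eq_square)
end

instantiation quat :: real_conj_div_algebra
begin
definition conj_quat :: "quat \<Rightarrow> quat" where "conj_quat = quat_cnj"
instance
  by standard
    (unfold norm_quat_square, simp_all add: conj_quat_def quat_cnj_def quat_eq_iff
      power2_eq_square algebra_simps)
end

section \<open>Projective space\<close>

definition herm :: "'k::real_conj_div_algebra ^ 'd \<Rightarrow> 'k ^ 'd \<Rightarrow> 'k"
  where "herm x y = (\<Sum>i\<in>UNIV. x $ i * conj (y $ i))"

definition line :: "'k::real_conj_div_algebra ^ 'd \<Rightarrow> ('k ^ 'd) set"
  where "line x = {c *s x | c. True}"

definition proj_space :: "('k::real_conj_div_algebra ^ 'd) set set"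
  where "proj_space = {line x | x. x \<noteq> 0}"

definition proj_t :: "('k::real_conj_div_algebra ^ 'd) set \<Rightarrow> ('k ^ 'd) set \<Rightarrow> real"
  where "proj_t P Q =
    (THE r. \<exists>x\<in>P. \<exists>y\<in>Q. herm x x = 1 \<and> herm y y = 1 \<and> r = (norm (herm x y))\<^sup>2)"

text \<open>
  Real-valued functions are only considered up to their values on \<^const>\<open>proj_space\<close>.
\<close>

definition Pol :: "nat \<Rightarrow> (('k::real_conj_div_algebra ^ 'd) set \<Rightarrow> real) set"
  where "Pol p = {f. \<exists>F c. finite F \<and> F \<subseteq> proj_space \<and>
    (\<forall>P\<in>proj_space. f P = (\<Sum>Q\<in>F. c Q * proj_t P Q ^ p))}"

section \<open>The invariant measure and designs\<close>

definition herm_isometry :: "('k::real_conj_div_algebra ^ 'd \<Rightarrow> 'k ^ 'd) \<Rightarrow> bool"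
  where "herm_isometry g \<longleftrightarrow>
    (\<forall>x y. g (x + y) = g x + g y) \<and> (\<forall>c x. g (c *s x) = c *s g x) \<and>
    (\<forall>x y. herm (g x) (g y) = herm x y)"

text \<open>
  The Borel \<open>\<sigma>\<close>-algebra of the quotient topology, for which a set of lines is open
  iff the set of nonzero vectors spanning one of them is.
\<close>

definition proj_borel :: "('k::real_conj_div_algebra ^ 'd) set measure"
  where "proj_borel =
    sigma proj_space {U. U \<subseteq> proj_space \<and> open {x. x \<noteq> 0 \<and> line x \<in> U}}"

text \<open>
  The normalized Lebesgue measure, given by the properties that determine it: it is the
  probability measure invariant under the isometry group of \<^const>\<open>herm\<close>.
\<close>

definition normalized_invariant :: "('k::real_conj_div_algebra ^ 'd) set measure \<Rightarrow> bool"
  where "normalized_invariant \<sigma> \<longleftrightarrow>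
    space \<sigma> = proj_space \<and> sets \<sigma> = sets proj_borel \<and> emeasure \<sigma> proj_space = 1 \<and>
    (\<forall>g. herm_isometry g \<longrightarrow>
      (\<forall>A\<in>sets \<sigma>. emeasure \<sigma> ((\<lambda>P. g ` P) ` A) = emeasure \<sigma> A))"

definition is_design ::
    "('k::real_conj_div_algebra ^ 'd) set measure \<Rightarrow> nat \<Rightarrow> ('k ^ 'd) set set \<Rightarrow> bool"
  where "is_design \<sigma> p S \<longleftrightarrow> finite S \<and> S \<noteq> {} \<and> S \<subseteq> proj_space \<and>
    (\<forall>f\<in>Pol p. integral\<^sup>L \<sigma> f = 1 / real (card S) * (\<Sum>P\<in>S. f P))"

section \<open>Tight fusion frames\<close>

definition orth_proj :: "'a::euclidean_space set \<Rightarrow> 'a \<Rightarrow> 'a"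
  where "orth_proj V x = (THE y. y \<in> V \<and> (\<forall>v\<in>V. (x - y) \<bullet> v = 0))"

definition tight_fusion_frame :: "nat \<Rightarrow> 'i set \<Rightarrow> ('i \<Rightarrow> 'a::euclidean_space set) \<Rightarrow> bool"
  where "tight_fusion_frame p I V \<longleftrightarrow> finite I \<and> (\<forall>j\<in>I. subspace (V j)) \<and>
    (\<exists>A>0. \<forall>x. (\<Sum>j\<in>I. norm (orth_proj (V j) x) ^ (2 * p)) = A * norm x ^ (2 * p))"

section \<open>Identification with real coordinate space\<close>

text \<open>In the type \<open>4\<close>, the numeral \<open>4\<close> equals \<open>0\<close>; its elements are \<open>0\<close>, \<open>1\<close>, \<open>2\<close>, \<open>3\<close>.\<close>

definition complex_coords :: "complex ^ 'd \<Rightarrow> real ^ ('d \<times> 2)"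
  where "complex_coords x = (\<chi> j. case j of (i, k) \<Rightarrow> if k = 0 then Re (x $ i) else Im (x $ i))"

definition quat_coords :: "quat ^ 'd \<Rightarrow> real ^ ('d \<times> 4)"
  where "quat_coords x = (\<chi> j. case j of (i, k) \<Rightarrow>
    if k = 0 then qRe (x $ i) else if k = 1 then qI (x $ i)
    else if k = 2 then qJ (x $ i) else qK (x $ i))"

end

theory Submission
  imports Defs
begin

text \<open>
  Let \<open>K\<close> be \<open>\<complex>\<close> or \<open>\<H>\<close>. The orthogonal projection of \<open>x\<close> onto the line \<open>P\<close> has squared norm
  \<open>t(P, Kx) \<parallel>x\<parallel>\<^sup>2\<close> (\<open>norm_orth_proj_line\<close>). So the \<open>2p\<close>-th powers of the norms of the projections
  of \<open>x\<close> onto the lines of a finite set \<open>S\<close> add up to \<open>\<parallel>x\<parallel>\<^sup>2\<^sup>p\<close> times the sum of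
  \<open>t(P, Kx)\<^sup>p\<close> over \<open>P \<in> S\<close>, and \<open>S\<close> is a tight \<open>p\<close>-fusion frame as soon as the sum of
  \<open>t(P, Q)\<^sup>p\<close> over \<open>P \<in> S\<close> is positive and does not depend on the line \<open>Q\<close>
  (\<open>design_sum_const\<close>).

  If \<open>S\<close> is a \<open>p\<close>-design, this sum is \<open>\<bar>S\<bar>\<close> times the integral of \<open>P \<mapsto> t(P, Q)\<^sup>p\<close>. That
  integral does not depend on \<open>Q\<close>, because \<open>t\<close> and the measure are invariant under the isometry
  group of the hermitian form, and this group is transitive on lines: a hyperplane reflection
  takes any given line to any other (\<open>exists_swapping_isometry\<close>). The sum is positive because for
  \<open>Q \<in> S\<close> it contains the term \<open>t(Q, Q)\<^sup>p = 1\<close>.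

  All this works over any real normed division algebra with a conjugation. The identification with
  a Euclidean space enters only through its being a linear surjective isometry.
\<close>

section \<open>Conjugation and the hermitian form\<close>

lemma conj_zero [simp]: "conj (0 :: 'k::real_conj_div_algebra) = 0"
  using conj_add[of "0::'k" 0] by simp

text \<open>
  Cancelling \<open>r\<close> in \<open>r * conj r = r\<^sup>2\<close> shows that real scalars are their own conjugates.
\<close>

lemma conj_scaleR_one: "conj (r *\<^sub>R (1 :: 'k::real_conj_div_algebra)) = r *\<^sub>R 1"
proof (cases "r = 0")
  case False
  have "(r *\<^sub>R (1::'k)) * conj (r *\<^sub>R 1) = (r *\<^sub>R 1) * (r *\<^sub>R 1)"
    by (simp only: mult_conj) (simp add: power2_eq_square)
  then have "r *\<^sub>R conj (r *\<^sub>R (1::'k)) = r *\<^sub>R (r *\<^sub>R 1)" by simp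
  then show ?thesis using False by (simp only: scaleR_cancel_left) simp
qed simp

lemma conj_scaleR: "conj (r *\<^sub>R (x :: 'k::real_conj_div_algebra)) = r *\<^sub>R conj x"
  using conj_mult[of "r *\<^sub>R 1" x] by (simp add: conj_scaleR_one)

lemma norm_conj [simp]: "norm (conj (x :: 'k::real_conj_div_algebra)) = norm x"
proof (cases "x = 0")
  case False
  have "norm x * norm (conj x) = norm x * norm x"
    using arg_cong[OF mult_conj[of x], of norm] by (simp add: norm_mult power2_eq_square)
  then show ?thesis using False by simp
qed simp

lemma conj_sum: "conj (\<Sum>i\<in>A. f i) = (\<Sum>i\<in>A. conj (f i :: 'k::real_conj_div_algebra))"
  by (induction A rule: infinite_finite_induct) (simp_all add: conj_add)

lemma herm_add_left: "herm (x + y) z = herm x z + herm y z"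
  by (simp add: herm_def distrib_right sum.distrib)

lemma herm_add_right: "herm x (y + z) = herm x y + herm x z"
  by (simp add: herm_def conj_add distrib_left sum.distrib)

lemma herm_smult_left: "herm (c *s x) y = c * herm x y"
  by (simp add: herm_def sum_distrib_left mult.assoc)

lemma herm_smult_right: "herm x (c *s y) = herm x y * conj c"
  by (simp add: herm_def sum_distrib_right conj_mult mult.assoc)

lemma herm_commute: "herm y x = conj (herm x y)"
  by (simp add: herm_def conj_sum conj_mult conj_conj)

lemma herm_diff_left: "herm (x - y) z = herm x z - herm y z"
  using herm_add_left[of "x - y" y z] by (simp add: algebra_simps)

lemma herm_diff_right: "herm x (y - z) = herm x y - herm x z"
  using herm_add_right[of x "y - z" z] by (simp add: algebra_simps)

lemma herm_self: "herm x x = (norm x)\<^sup>2 *\<^sub>R 1"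
  by (simp add: herm_def mult_conj norm_vec_def L2_set_def sum_nonneg scaleR_sum_left)

lemma herm_self_eq_one_iff: "herm x x = 1 \<longleftrightarrow> norm x = 1"
proof -
  have "herm x x = 1 \<longleftrightarrow> (norm x)\<^sup>2 *\<^sub>R (1::'a) = 1 *\<^sub>R 1" by (simp add: herm_self)
  also have "\<dots> \<longleftrightarrow> (norm x)\<^sup>2 = 1" by (simp only: scaleR_right_imp_eq scaleR_cancel_right) simp
  also have "\<dots> \<longleftrightarrow> norm x = 1" by (simp add: power2_eq_1_iff) (smt (verit) norm_ge_zero)
  finally show ?thesis .
qed

lemma scaleR_eq_smult: "r *\<^sub>R (x :: 'k::real_normed_div_algebra ^ 'd) = (r *\<^sub>R 1) *s x"
  by (simp add: vec_eq_iff)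

lemma norm_smult: "norm (c *s (x :: 'k::real_normed_div_algebra ^ 'd)) = norm c * norm x"
  by (simp add: norm_vec_def norm_mult L2_set_right_distrib)

text \<open>
  Orthogonality for the hermitian form is turned into a statement about norms, since only norms
  are available on both sides of an identification of \<open>K\<^sup>d\<close> with a Euclidean space.
\<close>

lemma herm_pythagoras:
  assumes "herm x y = 0"
  shows "(norm (x + y))\<^sup>2 = (norm x)\<^sup>2 + (norm y)\<^sup>2"
proof -
  have "herm y x = 0" using assms by (simp add: herm_commute[of y x])
  then have "herm (x + y) (x + y) = herm x x + herm y y"
    using assms by (simp add: herm_add_left herm_add_right)
  then have "(norm (x + y))\<^sup>2 *\<^sub>R (1::'a) = ((norm x)\<^sup>2 + (norm y)\<^sup>2) *\<^sub>R 1"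
    by (simp only: herm_self scaleR_add_left)
  then show ?thesis by (simp only: scaleR_cancel_right) simp
qed

section \<open>Lines and their angles\<close>

lemma line_smult:
  assumes "c \<noteq> 0"
  shows "line (c *s x) = line x"
proof -
  have "\<exists>b. a *s x = b *s (c *s x)" for a
    using assms by (intro exI[of _ "a * inverse c"]) (simp add: vector_smult_assoc mult.assoc)
  then show ?thesis by (auto simp: line_def vector_smult_assoc)
qed

lemma line_in_proj_space: "x \<noteq> 0 \<Longrightarrow> line x \<in> proj_space"
  by (auto simp: proj_space_def)

lemma proj_spaceE:
  assumes "P \<in> proj_space"
  obtains x where "P = line x" "norm x = 1"
proof -
  obtain y where y: "P = line y" "y \<noteq> 0" using assms by (auto simp: proj_space_def)
  let ?c = "inverse (norm y) *\<^sub>R (1::'a)"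
  have "P = line (?c *s y)" "norm (?c *s y) = 1"
    using y by (simp_all add: line_smult norm_smult)
  then show ?thesis using that by blast
qed

lemma proj_t_line:
  assumes "x \<noteq> 0" "y \<noteq> 0"
  shows "proj_t (line x) (line y) = (norm (herm x y))\<^sup>2 / ((norm x)\<^sup>2 * (norm y)\<^sup>2)"
  unfolding proj_t_def
proof (rule the_equality)
  let ?a = "inverse (norm x) *\<^sub>R (1::'a)" and ?b = "inverse (norm y) *\<^sub>R (1::'a)"
  have "?a *s x \<in> line x" "?b *s y \<in> line y"
    by (auto simp: line_def)
  moreover have "herm (?a *s x) (?a *s x) = 1" "herm (?b *s y) (?b *s y) = 1"
    using assms by (simp_all add: herm_self_eq_one_iff norm_smult)
  moreover have "(norm (herm x y))\<^sup>2 / ((norm x)\<^sup>2 * (norm y)\<^sup>2) = (norm (herm (?a *s x) (?b *s y)))\<^sup>2"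
    using assms
    by (simp add: herm_smult_left herm_smult_right norm_mult power_mult_distrib field_simps)
  ultimately show "\<exists>u\<in>line x. \<exists>v\<in>line y. herm u u = 1 \<and> herm v v = 1 \<and>
      (norm (herm x y))\<^sup>2 / ((norm x)\<^sup>2 * (norm y)\<^sup>2) = (norm (herm u v))\<^sup>2"
    by blast
next
  fix r
  assume "\<exists>u\<in>line x. \<exists>v\<in>line y. herm u u = 1 \<and> herm v v = 1 \<and> r = (norm (herm u v))\<^sup>2"
  then obtain a b where "norm a * norm x = 1" "norm b * norm y = 1"
    and r: "r = (norm (herm (a *s x) (b *s y)))\<^sup>2"
    by (auto simp: line_def herm_self_eq_one_iff norm_smult)
  then have "norm a = inverse (norm x)" "norm b = inverse (norm y)"
    using assms by (simp_all add: field_simps)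
  then show "r = (norm (herm x y))\<^sup>2 / ((norm x)\<^sup>2 * (norm y)\<^sup>2)"
    by (simp add: r herm_smult_left herm_smult_right norm_mult power_mult_distrib field_simps)
qed

lemma proj_t_nonneg:
  assumes "P \<in> proj_space" "Q \<in> proj_space"
  shows "proj_t P Q \<ge> 0"
  using assms by (auto simp: proj_space_def proj_t_line)

lemma proj_t_self:
  assumes "P \<in> proj_space"
  shows "proj_t P P = 1"
  using assms by (auto simp: proj_space_def proj_t_line herm_self power2_eq_square)

section \<open>Isometries acting on lines\<close>

lemma herm_isometry_norm:
  assumes "herm_isometry g"
  shows "norm (g x) = norm x"
proof -
  have "herm (g x) (g x) = herm x x" using assms by (simp add: herm_isometry_def)
  then have "(norm (g x))\<^sup>2 = (norm x)\<^sup>2" by (simp add: herm_self)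
  then show ?thesis by simp
qed

lemma herm_isometry_continuous:
  fixes g :: "'k::real_conj_div_algebra ^ 'd \<Rightarrow> 'k ^ 'd"
  assumes "herm_isometry g"
  shows "continuous_on UNIV g"
proof -
  have add: "g (x + y) = g x + g y" for x y
    using assms by (simp add: herm_isometry_def)
  have "g (x - y) = g x - g y" for x y
    using add[of "x - y" y] by (simp add: algebra_simps)
  then have "dist (g x) (g y) = dist x y" for x y
    using herm_isometry_norm[OF assms, of "x - y"] by (simp add: dist_norm)
  then show ?thesis by (auto simp: continuous_on_iff)
qed

lemma herm_isometry_line:
  assumes "herm_isometry g"
  shows "g ` line x = line (g x)"
proof -
  have "line y = range (\<lambda>c. c *s y)" for y :: "'a ^ 'b" by (auto simp: line_def)
  then show ?thesis using assms by (simp add: herm_isometry_def image_image)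
qed

lemma herm_isometry_nonzero:
  assumes "herm_isometry g"
  shows "g x = 0 \<longleftrightarrow> x = 0"
  using herm_isometry_norm[OF assms, of x] by (metis norm_eq_zero)

lemma herm_isometry_proj_space:
  assumes "herm_isometry g" "P \<in> proj_space"
  shows "g ` P \<in> proj_space"
  using assms
  by (auto simp: proj_space_def herm_isometry_line) (metis herm_isometry_nonzero)

lemma proj_t_isometry:
  assumes g: "herm_isometry g" and "P \<in> proj_space" "Q \<in> proj_space"
  shows "proj_t (g ` P) (g ` Q) = proj_t P Q"
proof -
  obtain x y where *: "P = line x" "x \<noteq> 0" "Q = line y" "y \<noteq> 0"
    using assms by (auto simp: proj_space_def)
  moreover have "herm (g x) (g y) = herm x y" using g by (simp add: herm_isometry_def)
  ultimately show ?thesis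
    using g by (simp add: herm_isometry_line proj_t_line herm_isometry_nonzero herm_isometry_norm)
qed

text \<open>
  The Householder reflection in the hyperplane orthogonal to \<open>u\<close>. The scalar stands on the left
  of the vector, so the map is \<open>K\<close>-linear for noncommutative \<open>K\<close> too. For \<open>u = 0\<close> the convention
  \<open>2 / 0 = 0\<close> makes it the identity.
\<close>

definition reflection :: "'k::real_conj_div_algebra ^ 'd \<Rightarrow> 'k ^ 'd \<Rightarrow> 'k ^ 'd"
  where "reflection u z = z - ((2 / (norm u)\<^sup>2) *\<^sub>R herm z u) *s u"

lemma herm_isometry_reflection: "herm_isometry (reflection u)"
proof -
  define s where "s = 2 / (norm u)\<^sup>2"
  \<comment> \<open>This identity makes the mixed and quadratic terms cancel; it also holds for \<open>u = 0\<close>.\<close>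
  have s: "s * (s * (norm u)\<^sup>2) = 2 * s" by (simp add: s_def)
  have "herm (reflection u z) (reflection u w) = herm z w" for z w
  proof -
    have "herm (reflection u z) (reflection u w)
        = herm z w - s *\<^sub>R (herm z u * herm u w) - s *\<^sub>R (herm z u * herm u w)
          + (s * (s * (norm u)\<^sup>2)) *\<^sub>R (herm z u * herm u w)"
      by (simp add: reflection_def s_def[symmetric] herm_diff_left herm_diff_right
          herm_smult_left herm_smult_right conj_scaleR herm_commute[of u w]
          herm_self mult.assoc algebra_simps)
    also have "\<dots> = herm z w" unfolding s by (simp flip: scaleR_2 add: algebra_simps)
    finally show ?thesis .
  qed
  moreover have "reflection u (x + y) = reflection u x + reflection u y" for x y
    by (simp add: reflection_def herm_add_left vec_eq_iff algebra_simps)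
  moreover have "reflection u (c *s x) = c *s reflection u x" for c x
    by (simp add: reflection_def herm_smult_left vec_eq_iff algebra_simps)
  ultimately show ?thesis by (simp add: herm_isometry_def)
qed

lemma reflection_involution: "reflection u (reflection u z) = z"
proof -
  define s where "s = 2 / (norm u)\<^sup>2"
  have s: "s * (s * (norm u)\<^sup>2) = 2 * s" by (simp add: s_def)
  have "s *\<^sub>R herm (reflection u z) u = s *\<^sub>R herm z u - (s * (s * (norm u)\<^sup>2)) *\<^sub>R herm z u"
    by (simp add: reflection_def s_def[symmetric] herm_diff_left herm_smult_left herm_self
        algebra_simps)
  also have "\<dots> = - (s *\<^sub>R herm z u)"
    unfolding s by (simp flip: scaleR_2 add: algebra_simps)
  finally have "s *\<^sub>R herm (reflection u z) u = - (s *\<^sub>R herm z u)" .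
  then have "reflection u (reflection u z) = reflection u z - (- (s *\<^sub>R herm z u)) *s u"
    by (simp add: reflection_def[of u "reflection u z"] s_def)
  also have "\<dots> = z"
    by (simp add: reflection_def[of u z] s_def vec_eq_iff)
  finally show ?thesis .
qed

text \<open>
  Choose unit vectors \<open>x\<close>, \<open>y\<close> on the two lines. Multiplying \<open>y\<close> by a unit scalar \<open>a\<close> makes
  \<open>h(x, a y)\<close> real, and then the reflection in \<open>x - a y\<close> takes \<open>x\<close> to \<open>a y\<close>, exactly as in the
  real case.
\<close>

lemma exists_swapping_isometry:
  assumes "P \<in> proj_space" "Q \<in> proj_space"
  obtains g where "herm_isometry g" "\<And>x. g (g x) = x" "g ` P = Q"
proof -
  obtain x where x: "P = line x" "norm x = 1" using assms(1) by (rule proj_spaceE)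
  obtain y where y: "Q = line y" "norm y = 1" using assms(2) by (rule proj_spaceE)
  obtain a and r :: real where a: "norm a = 1" and r: "herm x (a *s y) = r *\<^sub>R 1"
  proof (cases "herm x y = 0")
    case True
    then show ?thesis using that[of 1 0] by (simp add: herm_smult_right)
  next
    case False
    \<comment> \<open>The form is conjugate linear on the right, so \<open>a\<close> itself, not its conjugate, is the phase of \<open>h(x, y)\<close>.\<close>
    let ?a = "inverse (norm (herm x y)) *\<^sub>R herm x y"
    have "herm x (?a *s y) = norm (herm x y) *\<^sub>R 1"
      using False by (simp add: herm_smult_right conj_scaleR mult_conj power2_eq_square)
    moreover have "norm ?a = 1" using False by simp
    ultimately show ?thesis using that by blast
  qed
  define w where "w = a *s y"
  define u where "u = x - w"
  have w: "norm w = 1" "herm x w = r *\<^sub>R 1" "herm w x = r *\<^sub>R 1"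
    using a y r by (simp_all add: w_def norm_smult herm_commute[of _ x] conj_scaleR_one)
  have "herm u u = (2 - 2 * r) *\<^sub>R 1"
    using x w by (simp add: u_def herm_diff_left herm_diff_right herm_self[of x] herm_self[of w]
        algebra_simps flip: scaleR_2)
  then have nu: "(norm u)\<^sup>2 = 2 - 2 * r"
    by (simp only: herm_self scaleR_cancel_right) simp
  have xu: "herm x u = (1 - r) *\<^sub>R 1"
    using x w by (simp add: u_def herm_diff_right herm_self[of x] algebra_simps)
  have "reflection u x = w"
  proof (cases "u = 0")
    case True
    then show ?thesis by (simp add: reflection_def u_def)
  next
    case False
    then have "2 - 2 * r \<noteq> 0" using nu by (metis norm_eq_zero power_eq_0_iff)
    then have "2 / (norm u)\<^sup>2 * (1 - r) = 1" unfolding nu by (simp add: field_simps)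
    then have "reflection u x = x - 1 *s u" by (simp only: reflection_def xu scaleR_scaleR scaleR_one)
    then show ?thesis by (simp add: u_def)
  qed
  moreover have "a \<noteq> 0" using a by auto
  then have "line w = Q" using y by (simp add: w_def line_smult)
  ultimately have "reflection u ` P = Q"
    using x by (simp add: herm_isometry_line herm_isometry_reflection)
  then show ?thesis using that herm_isometry_reflection reflection_involution by blast
qed

section \<open>Invariant integration and designs\<close>

lemma herm_isometry_measurable:
  fixes \<sigma> :: "('k::real_conj_div_algebra ^ 'd) set measure"
  assumes \<sigma>: "normalized_invariant \<sigma>" and g: "herm_isometry g"
  shows "(`) g \<in> measurable \<sigma> \<sigma>"
proof -
  let ?G = "{U :: ('k ^ 'd) set set. U \<subseteq> proj_space \<and> open {x. x \<noteq> 0 \<and> line x \<in> U}}"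
  have "(`) g \<in> measurable proj_borel proj_borel"
    unfolding proj_borel_def
  proof (rule measurable_measure_of)
    show "?G \<subseteq> Pow proj_space" by auto
    show "(`) g \<in> space (sigma proj_space ?G) \<rightarrow> proj_space"
      using herm_isometry_proj_space[OF g] by (simp add: space_measure_of_conv)
    fix U assume U: "U \<in> ?G"
    have "line x \<in> (`) g -` U \<inter> proj_space \<longleftrightarrow> line (g x) \<in> U" if "x \<noteq> 0" for x
      using that by (simp add: herm_isometry_line[OF g] line_in_proj_space)
    then have "{x. x \<noteq> 0 \<and> line x \<in> (`) g -` U \<inter> proj_space}
        = g -` {x. x \<noteq> 0 \<and> line x \<in> U}"
      unfolding vimage_def mem_Collect_eq herm_isometry_nonzero[OF g] by blast
    moreover have "open (g -` {x. x \<noteq> 0 \<and> line x \<in> U})"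
      using U by (intro open_vimage herm_isometry_continuous[OF g]) blast
    ultimately have "(`) g -` U \<inter> proj_space \<in> ?G" by simp
    then have "(`) g -` U \<inter> proj_space \<in> sets (sigma proj_space ?G)"
      by (intro in_measure_of) blast
    then show "(`) g -` U \<inter> space (sigma proj_space ?G) \<in> sets (sigma proj_space ?G)"
      by (simp add: space_measure_of_conv)
  qed
  then show ?thesis
    using \<sigma> measurable_cong_sets[of \<sigma> proj_borel \<sigma> proj_borel] by (simp add: normalized_invariant_def)
qed

text \<open>
  Invariance of the measure is a condition on direct images, integration needs it for preimages.
  For an involution the two coincide.
\<close>

lemma distr_involutive_isometry:
  assumes \<sigma>: "normalized_invariant \<sigma>" and g: "herm_isometry g" and inv: "\<And>x. g (g x) = x"
  shows "distr \<sigma> \<sigma> ((`) g) = \<sigma>"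
proof (rule measure_eqI)
  fix A assume "A \<in> sets (distr \<sigma> \<sigma> ((`) g))"
  then have A: "A \<in> sets \<sigma>" by simp
  have gg: "g ` g ` P = P" for P using inv by (simp add: image_image)
  have sp: "space \<sigma> = proj_space" using \<sigma> by (simp add: normalized_invariant_def)
  have "A \<subseteq> proj_space" using sets.sets_into_space[OF A] sp by simp
  have "(`) g -` A \<inter> space \<sigma> = (`) g ` A"
  proof (intro set_eqI iffI)
    fix P assume "P \<in> (`) g -` A \<inter> space \<sigma>"
    then show "P \<in> (`) g ` A" using gg by (intro image_eqI[of _ _ "g ` P"]) auto
  next
    fix P assume "P \<in> (`) g ` A"
    then show "P \<in> (`) g -` A \<inter> space \<sigma>"
      using gg sp \<open>A \<subseteq> proj_space\<close> herm_isometry_proj_space[OF g] by auto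
  qed
  moreover have "emeasure \<sigma> ((`) g ` A) = emeasure \<sigma> A"
    using \<sigma> g A by (simp add: normalized_invariant_def)
  ultimately show "emeasure (distr \<sigma> \<sigma> ((`) g)) A = emeasure \<sigma> A"
    using emeasure_distr[OF herm_isometry_measurable[OF \<sigma> g] A] by simp
qed simp

lemma is_designD:
  assumes "is_design \<sigma> p S"
  shows "finite S" "S \<subseteq> proj_space" "S \<noteq> {}"
  using assms unfolding is_design_def by blast+

text \<open>
  The integrability of \<open>P \<mapsto> t(P, Q\<^sub>0)\<^sup>p\<close> for \<open>Q\<^sub>0 \<in> S\<close> comes for free: by the design property its
  integral is a positive average, whereas the integral of a function that is not integrable is \<open>0\<close>
  by convention. Every other line \<open>Q\<close> is then reached from \<open>Q\<^sub>0\<close> by an isometry.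
\<close>

lemma design_sum_const:
  assumes \<sigma>: "normalized_invariant \<sigma>" and S: "is_design \<sigma> p S"
  obtains A where "A > 0" "\<And>Q. Q \<in> proj_space \<Longrightarrow> (\<Sum>P\<in>S. proj_t P Q ^ p) = A"
proof -
  note fin = is_designD[OF S]
  then obtain Q0 where Q0: "Q0 \<in> S" "Q0 \<in> proj_space" by blast
  have card: "real (card S) > 0" using fin by (simp add: card_gt_0_iff)
  have int: "(\<Sum>P\<in>S. proj_t P Q ^ p) = real (card S) * (\<integral>P. proj_t P Q ^ p \<partial>\<sigma>)"
    if "Q \<in> proj_space" for Q
  proof -
    have "(\<lambda>P. proj_t P Q ^ p) \<in> Pol p"
      unfolding Pol_def using that by (auto intro!: exI[of _ "{Q}"] exI[of _ "\<lambda>_. 1"])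
    then have "(\<integral>P. proj_t P Q ^ p \<partial>\<sigma>) = 1 / real (card S) * (\<Sum>P\<in>S. proj_t P Q ^ p)"
      using S unfolding is_design_def by blast
    then show ?thesis using card by simp
  qed
  have "proj_t Q0 Q0 ^ p \<le> (\<Sum>P\<in>S. proj_t P Q0 ^ p)"
    using Q0 fin by (intro member_le_sum) (auto intro!: zero_le_power proj_t_nonneg)
  then have pos: "(\<Sum>P\<in>S. proj_t P Q0 ^ p) > 0" using Q0 by (simp add: proj_t_self)
  then have "integrable \<sigma> (\<lambda>P. proj_t P Q0 ^ p)"
    using int[OF Q0(2)] not_integrable_integral_eq by fastforce
  then have meas: "(\<lambda>P. proj_t P Q0 ^ p) \<in> borel_measurable \<sigma>" by (rule borel_measurable_integrable)
  have "(\<Sum>P\<in>S. proj_t P Q ^ p) = (\<Sum>P\<in>S. proj_t P Q0 ^ p)" if Q: "Q \<in> proj_space" for Q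
  proof -
    obtain g where g: "herm_isometry g" "\<And>x. g (g x) = x" "g ` Q = Q0"
      using exists_swapping_isometry[OF Q Q0(2)] by blast
    have "(\<integral>P. proj_t P Q ^ p \<partial>\<sigma>) = (\<integral>P. proj_t (g ` P) Q0 ^ p \<partial>\<sigma>)"
      using proj_t_isometry[OF g(1) _ Q] g(3) \<sigma>
      by (intro Bochner_Integration.integral_cong) (auto simp: normalized_invariant_def)
    also have "\<dots> = (\<integral>P. proj_t P Q0 ^ p \<partial>distr \<sigma> \<sigma> ((`) g))"
      by (rule integral_distr[OF herm_isometry_measurable[OF \<sigma> g(1)] meas, symmetric])
    also have "\<dots> = (\<integral>P. proj_t P Q0 ^ p \<partial>\<sigma>)"
      by (simp add: distr_involutive_isometry[OF \<sigma> g(1,2)])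
    finally show ?thesis using int Q Q0 by simp
  qed
  then show ?thesis using that pos by blast
qed

section \<open>Lines as subspaces of a Euclidean space\<close>

lemma orth_proj_eqI:
  assumes V: "subspace V" and "y \<in> V" "\<And>v. v \<in> V \<Longrightarrow> (x - y) \<bullet> v = 0"
  shows "orth_proj V x = y"
  unfolding orth_proj_def
proof (rule the_equality)
  fix z assume z: "z \<in> V \<and> (\<forall>v\<in>V. (x - z) \<bullet> v = 0)"
  have "z - y \<in> V" using V z assms(2) by (simp add: subspace_diff)
  then have "(z - y) \<bullet> (z - y) = (x - y) \<bullet> (z - y) - (x - z) \<bullet> (z - y)"
    by (simp add: algebra_simps)
  then have "(z - y) \<bullet> (z - y) = 0" using \<open>z - y \<in> V\<close> z assms(3) by simp
  then show "z = y" by simp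
qed (use assms in blast)

lemma subspace_line: "subspace (line x)"
proof (rule subspaceI)
  show "0 \<in> line x" by (auto simp: line_def intro!: exI[of _ 0])
next
  fix u v assume "u \<in> line x" "v \<in> line x"
  then show "u + v \<in> line x"
    by (auto simp: line_def simp flip: vector_sadd_rdistrib)
next
  fix c u assume "u \<in> line x"
  then show "c *\<^sub>R u \<in> line x"
    by (auto simp: line_def scaleR_eq_smult vector_smult_assoc)
qed

lemma inner_isometric_image_eq_zero:
  fixes \<phi> :: "'k::real_conj_div_algebra ^ 'd \<Rightarrow> 'e::euclidean_space"
  assumes "linear \<phi>" "\<And>x. norm (\<phi> x) = norm x" "herm x y = 0"
  shows "\<phi> x \<bullet> \<phi> y = 0"
proof -
  have "(norm (\<phi> x + \<phi> y))\<^sup>2 = (norm (\<phi> x))\<^sup>2 + (norm (\<phi> y))\<^sup>2"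
    using herm_pythagoras[OF assms(3)] assms(1,2) by (metis linear_add)
  then show ?thesis by (simp add: power2_norm_eq_inner algebra_simps inner_commute)
qed

text \<open>For a unit vector \<open>u\<close>, the projection of \<open>x\<close> onto \<open>Ku\<close> is \<open>h(x, u) u\<close>.\<close>

lemma norm_orth_proj_line:
  fixes \<phi> :: "'k::real_conj_div_algebra ^ 'd \<Rightarrow> 'e::euclidean_space"
  assumes \<phi>: "linear \<phi>" "\<And>x. norm (\<phi> x) = norm x" and P: "P \<in> proj_space" and x: "x \<noteq> 0"
  shows "(norm (orth_proj (\<phi> ` P) (\<phi> x)))\<^sup>2 = proj_t P (line x) * (norm x)\<^sup>2"
proof -
  obtain u where u: "P = line u" "norm u = 1" using P by (rule proj_spaceE)
  let ?y = "herm x u *s u"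
  have "orth_proj (\<phi> ` P) (\<phi> x) = \<phi> ?y"
  proof (rule orth_proj_eqI)
    show "subspace (\<phi> ` P)" using \<phi> u by (simp add: linear_subspace_image subspace_line)
    show "\<phi> ?y \<in> \<phi> ` P" using u by (auto simp: line_def)
    fix v assume "v \<in> \<phi> ` P"
    then obtain c where v: "v = \<phi> (c *s u)" using u by (auto simp: line_def)
    have "herm (x - ?y) (c *s u) = 0"
      using u by (simp add: herm_diff_left herm_smult_left herm_smult_right herm_self)
    then show "(\<phi> x - \<phi> ?y) \<bullet> v = 0"
      unfolding v linear_diff[OF \<phi>(1), symmetric] by (rule inner_isometric_image_eq_zero[OF \<phi>])
  qed
  moreover have "norm (herm u x) = norm (herm x u)" by (simp add: herm_commute[of u x])
  moreover have "u \<noteq> 0" using u by auto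
  ultimately show ?thesis using u x \<phi>(2) by (simp add: proj_t_line norm_smult)
qed

theorem design_imp_tight_fusion_frame:
  fixes \<phi> :: "'k::real_conj_div_algebra ^ 'd \<Rightarrow> 'e::euclidean_space"
  assumes \<phi>: "linear \<phi>" "\<And>x. norm (\<phi> x) = norm x" and surj: "surj \<phi>" and "p \<ge> 1"
    and \<sigma>: "normalized_invariant \<sigma>" and S: "is_design \<sigma> p S"
  shows "tight_fusion_frame p S (\<lambda>P. \<phi> ` P)"
proof -
  note fin = is_designD[OF S]
  have "subspace (\<phi> ` P)" if "P \<in> S" for P
    using that fin \<phi> by (auto simp: proj_space_def linear_subspace_image subspace_line)
  moreover obtain A where A: "A > 0" "\<And>Q. Q \<in> proj_space \<Longrightarrow> (\<Sum>P\<in>S. proj_t P Q ^ p) = A"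
    using design_sum_const[OF \<sigma> S] by blast
  have "(\<Sum>P\<in>S. norm (orth_proj (\<phi> ` P) z) ^ (2 * p)) = A * norm z ^ (2 * p)" for z
  proof -
    obtain x where z: "z = \<phi> x" using surj by auto
    show ?thesis
    proof (cases "x = 0")
      case True
      have "orth_proj (\<phi> ` P) 0 = 0" if "P \<in> S" for P
        using calculation[OF that] by (intro orth_proj_eqI) (auto simp: subspace_0)
      then show ?thesis using True z \<open>p \<ge> 1\<close> \<phi>(1) by (simp add: linear_0 power_0_left)
    next
      case False
      have "norm (orth_proj (\<phi> ` P) z) ^ (2 * p) = proj_t P (line x) ^ p * norm z ^ (2 * p)"
        if "P \<in> S" for P
        using norm_orth_proj_line[OF \<phi>, of P x] that fin False z \<phi>(2)
        by (auto simp: power_mult power_mult_distrib)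
      then show ?thesis
        using A(2)[of "line x"] False by (simp add: line_in_proj_space flip: sum_distrib_right)
    qed
  qed
  ultimately show ?thesis using fin A(1) by (auto simp: tight_fusion_frame_def)
qed

text \<open>
  A line \<open>Kx\<close> is a copy of \<open>K\<close>, so its real dimension is that of \<open>K\<close>. The parametrization \<open>\<psi>\<close>
  serves to name the latter for scalars that do not themselves form a Euclidean space type.
\<close>

lemma dim_line_image:
  fixes \<phi> :: "'k::real_conj_div_algebra ^ 'd \<Rightarrow> 'e::euclidean_space"
    and \<psi> :: "'b::euclidean_space \<Rightarrow> 'k"
  assumes \<phi>: "linear \<phi>" "\<And>x. norm (\<phi> x) = norm x" and \<psi>: "linear \<psi>" "bij \<psi>"
    and P: "P \<in> proj_space"
  shows "dim (\<phi> ` P) = DIM('b)"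
proof -
  obtain u where u: "P = line u" "norm u = 1" using P by (rule proj_spaceE)
  let ?f = "\<lambda>b. \<phi> (\<psi> b *s u)"
  have "linear (\<lambda>b. \<psi> b *s u)"
    using \<psi> by (intro linearI) (simp_all add: linear_add linear_scale vec_eq_iff algebra_simps)
  then have lin: "linear ?f" using linear_compose[OF _ \<phi>(1)] by (simp add: o_def)
  have "b = 0" if "?f b = 0" for b
  proof -
    have "norm (\<psi> b) = 0" using \<phi>(2)[of "\<psi> b *s u"] that u by (simp add: norm_smult)
    then have "\<psi> b = \<psi> 0" by (simp add: linear_0[OF \<psi>(1)])
    then show ?thesis using \<psi>(2) by (auto dest: bij_is_inj injD)
  qed
  then have "inj ?f" using linear_injective_0[OF lin] by blast
  have "P = (\<lambda>b. \<psi> b *s u) ` UNIV"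
  proof -
    have "P = (\<lambda>c. c *s u) ` \<psi> ` UNIV" using u bij_is_surj[OF \<psi>(2)] by (auto simp: line_def)
    then show ?thesis by (simp add: image_image)
  qed
  then have "\<phi> ` P = ?f ` UNIV" by (simp add: image_image)
  then show ?thesis using dim_image_eq[OF lin, of UNIV] \<open>inj ?f\<close> by simp
qed

section \<open>The complex and quaternionic coordinates\<close>

lemma linear_complex_coords: "linear complex_coords"
  by (rule linearI) (auto simp: complex_coords_def vec_eq_iff)

lemma norm_complex_coords: "norm (complex_coords x) = norm x"
proof -
  have "(\<Sum>k\<in>UNIV. (complex_coords x $ (i, k))\<^sup>2) = (norm (x $ i))\<^sup>2" for i
    by (simp add: complex_coords_def UNIV_2 cmod_power2)
  then have "(\<Sum>j\<in>UNIV. (complex_coords x $ j)\<^sup>2) = (\<Sum>i\<in>UNIV. (norm (x $ i))\<^sup>2)"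
    by (simp only: UNIV_Times_UNIV[symmetric] sum.cartesian_product')
  then show ?thesis by (simp add: norm_vec_def L2_set_def)
qed

lemma surj_complex_coords: "surj (complex_coords :: complex ^ 'd \<Rightarrow> _)"
proof (rule surjI)
  fix y :: "real ^ ('d \<times> 2)"
  have "k = 1" if "k \<noteq> 0" for k :: 2
    using that exhaust_2[of k] by auto
  then show "complex_coords (\<chi> i. Complex (y $ (i, 0)) (y $ (i, 1))) = y"
    by (simp add: complex_coords_def vec_eq_iff) metis
qed

lemma linear_quat_coords: "linear quat_coords"
  by (rule linearI) (auto simp: quat_coords_def vec_eq_iff)

lemma norm_quat_coords: "norm (quat_coords x) = norm x"
proof -
  have zero: "(4 :: 4) = 0" by simp
  have "(\<Sum>k\<in>UNIV. (quat_coords x $ (i, k))\<^sup>2) = (norm (x $ i))\<^sup>2" for i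
    unfolding sum_4 zero by (simp add: quat_coords_def norm_quat_square)
  then have "(\<Sum>j\<in>UNIV. (quat_coords x $ j)\<^sup>2) = (\<Sum>i\<in>UNIV. (norm (x $ i))\<^sup>2)"
    by (simp only: UNIV_Times_UNIV[symmetric] sum.cartesian_product')
  then show ?thesis by (simp add: norm_vec_def L2_set_def)
qed

lemma surj_quat_coords: "surj (quat_coords :: quat ^ 'd \<Rightarrow> _)"
proof (rule surjI)
  fix y :: "real ^ ('d \<times> 4)"
  have "k = 3" if "k \<noteq> 0" "k \<noteq> 1" "k \<noteq> 2" for k :: 4
    using that exhaust_4[of k] by auto
  then show "quat_coords (\<chi> i. Quat (y $ (i, 0)) (y $ (i, 1)) (y $ (i, 2)) (y $ (i, 3))) = y"
    by (simp add: quat_coords_def vec_eq_iff)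
qed

definition quat_of_tuple :: "real \<times> real \<times> real \<times> real \<Rightarrow> quat"
  where "quat_of_tuple = (\<lambda>(a, b, c, d). Quat a b c d)"

lemma linear_quat_of_tuple: "linear quat_of_tuple"
  by (rule linearI) (auto simp: quat_of_tuple_def quat_eq_iff)

lemma bij_quat_of_tuple: "bij quat_of_tuple"
  by (rule o_bij[of "\<lambda>q. (qRe q, qI q, qJ q, qK q)"]) (auto simp: quat_of_tuple_def fun_eq_iff)

theorem theorem6p4:
  fixes p :: nat
    and \<sigma>C :: "(complex ^ 'd) set measure" and SC :: "(complex ^ 'd) set set"
    and \<sigma>H :: "(quat ^ 'd) set measure" and SH :: "(quat ^ 'd) set set"
  assumes "p \<ge> 1"
  shows "(normalized_invariant \<sigma>C \<and> is_design \<sigma>C p SC \<longrightarrow>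
           tight_fusion_frame p SC (\<lambda>P. complex_coords ` P) \<and>
           (\<forall>P\<in>SC. dim (complex_coords ` P) = 2)) \<and>
         (normalized_invariant \<sigma>H \<and> is_design \<sigma>H p SH \<longrightarrow>
           tight_fusion_frame p SH (\<lambda>P. quat_coords ` P) \<and>
           (\<forall>P\<in>SH. dim (quat_coords ` P) = 4))"
proof (intro conjI impI ballI; elim conjE)
  assume *: "normalized_invariant \<sigma>C" "is_design \<sigma>C p SC"
  show "tight_fusion_frame p SC (\<lambda>P. complex_coords ` P)"
    by (rule design_imp_tight_fusion_frame[OF linear_complex_coords norm_complex_coords
          surj_complex_coords assms *])
  fix P assume "P \<in> SC"
  then have "P \<in> proj_space" using is_designD(2)[OF *(2)] by blast
  then have "dim (complex_coords ` P) = DIM(complex)"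
    by (rule dim_line_image[OF linear_complex_coords norm_complex_coords linear_id bij_id])
  then show "dim (complex_coords ` P) = 2" by simp
next
  assume *: "normalized_invariant \<sigma>H" "is_design \<sigma>H p SH"
  show "tight_fusion_frame p SH (\<lambda>P. quat_coords ` P)"
    by (rule design_imp_tight_fusion_frame[OF linear_quat_coords norm_quat_coords
          surj_quat_coords assms *])
  fix P assume "P \<in> SH"
  then have "P \<in> proj_space" using is_designD(2)[OF *(2)] by blast
  then have "dim (quat_coords ` P) = DIM(real \<times> real \<times> real \<times> real)"
    by (rule dim_line_image[OF linear_quat_coords norm_quat_coords
          linear_quat_of_tuple bij_quat_of_tuple])
  then show "dim (quat_coords ` P) = 4" by simp
qed

end
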